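(* Let $(\mathcal{V},\mathcal{E},\alpha)$ be a magnetic graph. The difference magnetic operator satisfies the following gauge invariance: for every real function $f:\mathcal{V}\to\mathbb{R}$ and every $g\in\mathcal{C}(\mathcal{V})$, $$d^0_{\alpha+d^0f}(e^{if}.g)=e^{if}.\,d^0_\alpha(g).$$
   Context: A magnetic graph consists of an at most countable vertex set $\mathcal{V}$, a symmetric edge set $\mathcal{E}\subset\mathcal{V}\times\mathcal{V}$ without loops (the graph is assumed connected and locally finite), and a magnetic potential $\alpha:\mathcal{E}\to\mathbb{R}$ with $\alpha(x,y)=-\alpha(y,x)$. $\mathcal{C}(\mathcal{V})$ is the set of functions $\mathcal{V}\to\mathbb{C}$; $\mathcal{C}_{skew}(\mathcal{E})$ is the set of $\varphi:\mathcal{E}\to\mathbb{C}$ with $\varphi(x,y)=-\varphi(y,x)$. Let $d^0f(x,y)=f(y)-f(x)$. The difference magnetic operator is $d^0_\alpha:\mathcal{C}(\mathcal{V})\to\mathcal{C}_{skew}(\mathcal{E})$, $d^0_\alpha g(x,y)=e^{\frac{i\alpha(y,x)}2}g(y)-e^{\frac{i\alpha(x,y)}2}g(x)$. The change of gauge given by a real function $f$ on $\mathcal{V}$ acts on $g\in\mathcal{C}(\mathcal{V})$ by $(e^{if}.g)(x)=e^{if(x)}g(x)$ and on $\varphi\in\mathcal{C}_{skew}(\mathcal{E})$ by $(e^{if}.\varphi)(x,y)=e^{i\tilde f(x,y)}\varphi(x,y)$ with $\tilde f(x,y)=\frac{f(x)+f(y)}2$. *)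

theory Defs
  imports Complex_Main "HOL-Library.Countable_Set" "HOL-Library.FuncSet"
begin

text \<open>
  Functions on a subset of a type are represented by extensional functions
  (\<open>\<rightarrow>\<^sub>E\<close>, value \<^term>\<open>undefined\<close> outside the domain), so that HOL equality is
  equality of functions on that subset.
\<close>

locale magnetic_graph =
  fixes V :: "'v set" and E :: "('v \<times> 'v) set" and \<alpha> :: "'v \<times> 'v \<Rightarrow> real"
  assumes countable_vertices: "countable V"
    and edges_subset: "E \<subseteq> V \<times> V"
    and edges_sym: "sym E"
    and no_loops: "irrefl E"
    and connected: "x \<in> V \<Longrightarrow> y \<in> V \<Longrightarrow> (x, y) \<in> E\<^sup>*"
    and locally_finite: "x \<in> V \<Longrightarrow> finite (E `` {x})"
    and potential_on_edges: "\<alpha> \<in> E \<rightarrow>\<^sub>E UNIV"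
    and potential_skew: "(x, y) \<in> E \<Longrightarrow> \<alpha> (x, y) = - \<alpha> (y, x)"

definition vertex_functions :: "'v set \<Rightarrow> ('v \<Rightarrow> complex) set" where
  "vertex_functions V = V \<rightarrow>\<^sub>E UNIV"

definition skew_functions :: "('v \<times> 'v) set \<Rightarrow> ('v \<times> 'v \<Rightarrow> complex) set" where
  "skew_functions E = {\<phi> \<in> E \<rightarrow>\<^sub>E UNIV. \<forall>(x, y) \<in> E. \<phi> (x, y) = - \<phi> (y, x)}"

definition edge_plus ::
    "('v \<times> 'v) set \<Rightarrow> ('v \<times> 'v \<Rightarrow> real) \<Rightarrow> ('v \<times> 'v \<Rightarrow> real) \<Rightarrow> 'v \<times> 'v \<Rightarrow> real" where
  "edge_plus E \<alpha> \<beta> = (\<lambda>e\<in>E. \<alpha> e + \<beta> e)"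

definition diff0 :: "('v \<times> 'v) set \<Rightarrow> ('v \<Rightarrow> 'b::ab_group_add) \<Rightarrow> 'v \<times> 'v \<Rightarrow> 'b" where
  "diff0 E f = (\<lambda>(x, y)\<in>E. f y - f x)"

definition magnetic_diff ::
    "('v \<times> 'v) set \<Rightarrow> ('v \<times> 'v \<Rightarrow> real) \<Rightarrow> ('v \<Rightarrow> complex) \<Rightarrow> 'v \<times> 'v \<Rightarrow> complex" where
  "magnetic_diff E \<alpha> g =
     (\<lambda>(x, y)\<in>E. exp (\<i> * complex_of_real (\<alpha> (y, x)) / 2) * g y
               - exp (\<i> * complex_of_real (\<alpha> (x, y)) / 2) * g x)"

definition gauge_vertex :: "'v set \<Rightarrow> ('v \<Rightarrow> real) \<Rightarrow> ('v \<Rightarrow> complex) \<Rightarrow> 'v \<Rightarrow> complex" where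
  "gauge_vertex V f g = (\<lambda>x\<in>V. exp (\<i> * complex_of_real (f x)) * g x)"

definition edge_mean :: "('v \<Rightarrow> real) \<Rightarrow> 'v \<times> 'v \<Rightarrow> real" where
  "edge_mean f = (\<lambda>(x, y). (f x + f y) / 2)"

definition gauge_edge ::
    "('v \<times> 'v) set \<Rightarrow> ('v \<Rightarrow> real) \<Rightarrow> ('v \<times> 'v \<Rightarrow> complex) \<Rightarrow> 'v \<times> 'v \<Rightarrow> complex" where
  "gauge_edge E f \<phi> = (\<lambda>e\<in>E. exp (\<i> * complex_of_real (edge_mean f e)) * \<phi> e)"

lemma gauge_vertex_in: "gauge_vertex V f g \<in> vertex_functions V"
  by (simp add: gauge_vertex_def vertex_functions_def)

lemma gauge_edge_in:
  assumes "sym E" "\<phi> \<in> skew_functions E"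
  shows "gauge_edge E f \<phi> \<in> skew_functions E"
proof -
  have "gauge_edge E f \<phi> (x, y) = - gauge_edge E f \<phi> (y, x)" if "(x, y) \<in> E" for x y
  proof -
    have "(y, x) \<in> E" using assms(1) that by (rule symD)
    moreover have "\<phi> (x, y) = - \<phi> (y, x)" using assms(2) that by (auto simp: skew_functions_def)
    ultimately show ?thesis using that by (simp add: gauge_edge_def edge_mean_def add.commute)
  qed
  then show ?thesis by (auto simp: skew_functions_def gauge_edge_def)
qed

context magnetic_graph
begin

lemma magnetic_diff_in: "magnetic_diff E \<alpha> g \<in> skew_functions E"
  using edges_sym by (auto simp: skew_functions_def magnetic_diff_def dest: symD)

lemma magnetic_graph_gauge: "magnetic_graph V E (edge_plus E \<alpha> (diff0 E f))"
proof
  fix x y assume e: "(x, y) \<in> E"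
  then have "(y, x) \<in> E" using edges_sym by (auto dest: symD)
  with e potential_skew[OF e]
  show "edge_plus E \<alpha> (diff0 E f) (x, y) = - edge_plus E \<alpha> (diff0 E f) (y, x)"
    by (simp add: edge_plus_def diff0_def)
qed (use countable_vertices edges_subset edges_sym no_loops connected locally_finite in
      \<open>auto simp: edge_plus_def irrefl_def dest: symD\<close>)

end

end

theory Submission
  imports Defs
begin

text \<open>Fix an edge \<open>(x, y)\<close>. At each endpoint the new potential contributes half
  the difference of \<open>f\<close>, taken as the other endpoint minus this one, while the gauge
  change of \<open>g\<close> contributes the full value of \<open>f\<close> there. The sum is the
  mean \<open>(f x + f y) / 2\<close>, which is symmetric in the endpoints. Both terms of the
  difference thus acquire the same phase, which factors out; \<open>exp_gauge_shift\<close> is this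
  computation for one term, with \<open>t\<close> the value of \<open>f\<close> at its own endpoint
  and \<open>s\<close> at the other.\<close>

lemma exp_gauge_shift:
  fixes a s t :: real and z :: complex
  shows "exp (\<i> * complex_of_real (a + (s - t)) / 2) * (exp (\<i> * complex_of_real t) * z)
       = exp (\<i> * complex_of_real ((s + t) / 2)) * (exp (\<i> * complex_of_real a / 2) * z)"
proof -
  have "\<i> * complex_of_real (a + (s - t)) / 2 + \<i> * complex_of_real t
      = \<i> * complex_of_real ((s + t) / 2) + \<i> * complex_of_real a / 2"
    by (simp add: field_simps)
  then show ?thesis
    by (simp only: mult.assoc[symmetric] exp_add[symmetric])
qed

theorem proposition3p1:
  fixes V :: "'v set" and E :: "('v \<times> 'v) set" and \<alpha> :: "'v \<times> 'v \<Rightarrow> real"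
    and f :: "'v \<Rightarrow> real" and g :: "'v \<Rightarrow> complex"
  assumes "magnetic_graph V E \<alpha>"
    and "f \<in> V \<rightarrow>\<^sub>E UNIV"
    and "g \<in> vertex_functions V"
  shows "magnetic_diff E (edge_plus E \<alpha> (diff0 E f)) (gauge_vertex V f g)
       = gauge_edge E f (magnetic_diff E \<alpha> g)"
proof
  interpret magnetic_graph V E \<alpha> by fact
  fix e :: "'v \<times> 'v"
  obtain x y where e: "e = (x, y)" by (cases e)
  show "magnetic_diff E (edge_plus E \<alpha> (diff0 E f)) (gauge_vertex V f g) e
      = gauge_edge E f (magnetic_diff E \<alpha> g) e"
  proof (cases "(x, y) \<in> E")
    case True
    \<comment> \<open>The restricted functions unfold only on their domains: the potential is also
      evaluated at the reversed edge, and the gauged \<open>g\<close> at both endpoints.\<close>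
    then have yx: "(y, x) \<in> E" and "x \<in> V" "y \<in> V"
      using edges_sym edges_subset by (auto dest: symD)
    then have "magnetic_diff E (edge_plus E \<alpha> (diff0 E f)) (gauge_vertex V f g) (x, y)
        = exp (\<i> * complex_of_real (\<alpha> (y, x) + (f x - f y)) / 2)
            * (exp (\<i> * complex_of_real (f y)) * g y)
        - exp (\<i> * complex_of_real (\<alpha> (x, y) + (f y - f x)) / 2)
            * (exp (\<i> * complex_of_real (f x)) * g x)"
      using True by (simp add: magnetic_diff_def edge_plus_def diff0_def gauge_vertex_def)
    also have "\<dots> = gauge_edge E f (magnetic_diff E \<alpha> g) (x, y)"
      \<comment> \<open>The term at \<open>x\<close> yields the mean with its summands swapped; once
        reordered, the two phases coincide and can be pulled out of the difference.\<close>
      unfolding exp_gauge_shift add.commute[of "f y" "f x"] using True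
      by (simp only: gauge_edge_def edge_mean_def magnetic_diff_def restrict_apply
          if_True prod.case right_diff_distrib)
    finally show ?thesis by (simp add: e)
  next
    case False
    \<comment> \<open>Off the edge set both sides are \<open>undefined\<close>.\<close>
    then show ?thesis by (simp add: e magnetic_diff_def gauge_edge_def)
  qed
qed

end
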